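(* Let $a, b, c, d$ be rational numbers such that the quantity $D = (a d - b c)/(2 a^2)$ is defined and nonzero (that is, $a \neq 0$ and $ad - bc \neq 0$). Consider the conic section $$\mathcal C: \quad a\,x\,y + b\,x + c\,y + d = 0.$$ If the elliptic curve $E^{(D)}: Y^2 = X^3 - D^2 X$ has infinitely many rational points $(X:Y:1)$, then there are infinitely many rational distance sets $S = \{P_1, P_2, P_3, P_4\}$ consisting of four rational points on $\mathcal C$ such that their pairwise distances $\|P_s - P_t\|$ are rational numbers.
   Context: Points on $\mathcal C$ are affine points $P_t = (x_t : y_t : 1)$, identified with $(x_t, y_t)$; such a point is rational if $x_t, y_t \in \mathbb Q$. The distance is Euclidean: $\|P_s - P_t\| = \sqrt{(x_s - x_t)^2 + (y_s - y_t)^2}$. A rational distance set on $\mathcal C$ is a collection of affine rational points on $\mathcal C$ whose pairwise distances are rational numbers. *)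

theory Defs
  imports "HOL-Analysis.Analysis"
begin

text \<open>
  The plane is \<^typ>\<open>real \<times> real\<close>, whose library metric \<^const>\<open>dist\<close> is the Euclidean one
  (\<^verbatim>\<open>dist_prod_def\<close>).
\<close>

definition conic_section :: "real \<Rightarrow> real \<Rightarrow> real \<Rightarrow> real \<Rightarrow> (real \<times> real) set" where
  "conic_section a b c d = {(x, y). a * x * y + b * x + c * y + d = 0}"

text \<open>The affine part of \<open>E\<^sup>(\<^sup>D\<^sup>)\<close>; the single point at infinity is omitted.\<close>

definition elliptic_curve :: "real \<Rightarrow> (real \<times> real) set" where
  "elliptic_curve D = {(X, Y). Y ^ 2 = X ^ 3 - D ^ 2 * X}"

definition rational_points :: "(real \<times> real) set \<Rightarrow> (real \<times> real) set" where
  "rational_points C = C \<inter> (\<rat> \<times> \<rat>)"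

definition rational_distance_set :: "(real \<times> real) set \<Rightarrow> (real \<times> real) set \<Rightarrow> bool" where
  "rational_distance_set C S \<longleftrightarrow>
     S \<subseteq> rational_points C \<and> (\<forall>P\<in>S. \<forall>Q\<in>S. dist P Q \<in> \<rat>)"

end

theory Submission
  imports Defs
begin

text \<open>
  Why the theorem holds.  Translating the axes turns the conic into the hyperbola
  \<open>u * v = -2 * D\<close>, whose rational points are parametrised by their nonzero rational abscissa
  \<open>u\<close>.  The chord between the parameters \<open>u\<close> and \<open>w\<close> has length
  \<open>\<bar>u - w\<bar> * sqrt ((u * w)\<^sup>2 + 4 * D\<^sup>2) / \<bar>u * w\<bar>\<close>, so only the product \<open>p = u * w\<close> matters:
  it has to be the leg of a rational right triangle whose other leg is \<open>2 * D\<close>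
  (\<open>dist_hyperbola_point_Rats\<close>).

  Four parameters with product \<open>4 * D\<^sup>2\<close> have six pairwise products that fall into three pairs
  \<open>{p, 4 * D\<^sup>2 / p}\<close>, and \<open>p \<mapsto> 4 * D\<^sup>2 / p\<close> sends legs to legs, because it rescales the triangle
  so that its two legs swap their roles.  Hence three legs \<open>p, q, r\<close> suffice.  The parameters can be
  recovered from these legs rationally as soon as \<open>p * q * r\<close> is a square, for example when each leg
  is itself a square.  Square legs are what the elliptic curve supplies: dividing
  \<open>Y\<^sup>2 = X\<^sup>3 - D\<^sup>2 * X\<close> by \<open>X\<^sup>2\<close> gives \<open>(Y / X)\<^sup>2 = X - D\<^sup>2 / X\<close>, and
  \<open>(X - D\<^sup>2 / X)\<^sup>2 + 4 * D\<^sup>2 = (X + D\<^sup>2 / X)\<^sup>2\<close>.  Infinitely many rational points on the curve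
  therefore give infinitely many square legs (\<open>infinite_square_leg_roots\<close>).  Any three of them in
  general position yield a quadruple (\<open>rational_distance_set_quadruple\<close>), and letting one of the
  three vary moves a vertex through infinitely many positions.
\<close>

section \<open>Legs of rational right triangles\<close>

definition rational_leg :: "real \<Rightarrow> real \<Rightarrow> bool" where
  "rational_leg D p \<longleftrightarrow> p \<noteq> 0 \<and> p \<in> \<rat> \<and> (\<exists>r\<in>\<rat>. p ^ 2 + 4 * D ^ 2 = r ^ 2)"

text \<open>Scaling the triangle with legs \<open>p\<close> and \<open>2 * D\<close> by \<open>2 * D / p\<close> makes the leg \<open>p\<close> the new
  \<open>2 * D\<close>.\<close>

lemma rational_leg_swap:
  assumes "rational_leg D p" "D \<in> \<rat>" "D \<noteq> 0"
  shows "rational_leg D (4 * D ^ 2 / p)"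
proof -
  from assms(1) obtain r where p: "p \<noteq> 0" "p \<in> \<rat>" and r: "r \<in> \<rat>" "p ^ 2 + 4 * D ^ 2 = r ^ 2"
    unfolding rational_leg_def by blast
  have "(4 * D ^ 2 / p) ^ 2 + 4 * D ^ 2 = (2 * D / p) ^ 2 * (p ^ 2 + 4 * D ^ 2)"
    using p by (simp add: field_simps power2_eq_square)
  also have "\<dots> = (2 * D * r / p) ^ 2"
    by (simp add: r power_mult_distrib power_divide)
  finally have "(4 * D ^ 2 / p) ^ 2 + 4 * D ^ 2 = (2 * D * r / p) ^ 2" .
  moreover have "2 * D * r / p \<in> \<rat>"
    using p r assms by simp
  ultimately show ?thesis
    unfolding rational_leg_def using p assms by auto
qed

definition square_leg_roots :: "real \<Rightarrow> real set" where
  "square_leg_roots D = {t \<in> \<rat>. t > 0 \<and> rational_leg D (t ^ 2)}"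

lemma square_leg_root_of_elliptic_curve:
  assumes "(X, Y) \<in> rational_points (elliptic_curve D)" "X \<noteq> 0" "Y \<noteq> 0"
  shows "\<bar>Y / X\<bar> \<in> square_leg_roots D"
proof -
  have XY: "X \<in> \<rat>" "Y \<in> \<rat>" "Y ^ 2 = X ^ 3 - D ^ 2 * X"
    using assms(1) by (auto simp: rational_points_def elliptic_curve_def)
  have "D ^ 2 / X \<in> \<rat>"
  proof -
    have "D ^ 2 / X = X - (Y / X) ^ 2"
      using XY(3) assms(2) by (simp add: field_simps power2_eq_square power3_eq_cube)
    then show ?thesis using XY by simp
  qed
  have "(Y / X) ^ 2 = X - D ^ 2 / X"
    using XY(3) assms(2) by (simp add: field_simps power2_eq_square power3_eq_cube)
  then have "((Y / X) ^ 2) ^ 2 + 4 * D ^ 2 = (X - D ^ 2 / X) ^ 2 + 4 * D ^ 2"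
    by simp
  also have "\<dots> = (X + D ^ 2 / X) ^ 2"
    using assms(2) by (simp add: field_simps power2_eq_square)
  finally have "((Y / X) ^ 2) ^ 2 + 4 * D ^ 2 = (X + D ^ 2 / X) ^ 2" .
  then have "rational_leg D (\<bar>Y / X\<bar> ^ 2)"
    unfolding rational_leg_def using assms(2,3) XY \<open>D ^ 2 / X \<in> \<rat>\<close>
    by (auto intro!: bexI[of _ "X + D ^ 2 / X"] simp del: abs_divide)
  then show ?thesis
    unfolding square_leg_roots_def using assms(2,3) XY by (simp add: Rats_abs_iff del: abs_divide)
qed

text \<open>The map \<open>(X, Y) \<mapsto> \<bar>Y / X\<bar>\<close> has finite fibres away from the axes: with \<open>t = \<bar>Y / X\<bar>\<close>, the abscissa
  \<open>X\<close> is a root of \<open>X\<^sup>2 - t\<^sup>2 * X - D\<^sup>2\<close>, and \<open>Y\<close> is \<open>t * X\<close> up to sign.\<close>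

lemma infinite_square_leg_roots:
  assumes "infinite (rational_points (elliptic_curve D))"
  shows "infinite (square_leg_roots D)"
proof
  assume fin: "finite (square_leg_roots D)"
  define x where "x t e = (t ^ 2 + e * sqrt (t ^ 4 + 4 * D ^ 2)) / 2" for t e :: real
  define F where "F = (\<lambda>(t, e, e'). (x t e, e' * t * x t e))"
  have "rational_points (elliptic_curve D) \<subseteq>
      {(0, 0), (D, 0), (- D, 0)} \<union> F ` (square_leg_roots D \<times> {1, - 1} \<times> {1, - 1})"
  proof (rule subsetI)
    fix P assume "P \<in> rational_points (elliptic_curve D)"
    then obtain X Y where P: "P = (X, Y)" and mem: "(X, Y) \<in> rational_points (elliptic_curve D)"
      by (cases P) auto
    have E: "Y ^ 2 = X ^ 3 - D ^ 2 * X"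
      using mem by (simp add: rational_points_def elliptic_curve_def)
    show "P \<in> {(0, 0), (D, 0), (- D, 0)} \<union> F ` (square_leg_roots D \<times> {1, - 1} \<times> {1, - 1})"
    proof (cases "X = 0 \<or> Y = 0")
      case True
      then have "Y = 0" using E by auto
      have "X * ((X - D) * (X + D)) = X ^ 3 - D ^ 2 * X"
        by (simp add: algebra_simps power2_eq_square power3_eq_cube)
      then have "X * ((X - D) * (X + D)) = 0"
        using E \<open>Y = 0\<close> by simp
      then have "X = 0 \<or> X = D \<or> X = - D"
        by (simp only: mult_eq_0_iff eq_iff_diff_eq_0[symmetric] eq_neg_iff_add_eq_0)
      then show ?thesis using P \<open>Y = 0\<close> by auto
    next
      case False
      define t where "t = \<bar>Y / X\<bar>"
      have t: "t \<in> square_leg_roots D"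
        unfolding t_def using mem False by (intro square_leg_root_of_elliptic_curve) auto
      have t2: "t ^ 2 = X - D ^ 2 / X"
        unfolding t_def using E False by (simp add: field_simps power2_eq_square power3_eq_cube)
      have "t ^ 4 + 4 * D ^ 2 = (t ^ 2) ^ 2 + 4 * D ^ 2" by simp
      also have "\<dots> = (2 * X - t ^ 2) ^ 2"
        unfolding t2 using False by (simp add: field_simps power2_eq_square)
      finally have "sqrt (t ^ 4 + 4 * D ^ 2) = \<bar>2 * X - t ^ 2\<bar>" by simp
      then have "X = x t 1 \<or> X = x t (- 1)"
        unfolding x_def by (auto simp: abs_if)
      moreover have "Y = 1 * t * X \<or> Y = - 1 * t * X"
        unfolding t_def using False by (auto simp: abs_if)
      ultimately obtain e e' where
        "e \<in> {1, - 1}" "e' \<in> {1, - 1}" "X = x t e" "Y = e' * t * X"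
        by blast
      then have "P = F (t, e, e')" "(t, e, e') \<in> square_leg_roots D \<times> {1, - 1} \<times> {1, - 1}"
        using P t by (auto simp: F_def)
      then show ?thesis by blast
    qed
  qed
  moreover have "finite ({(0, 0), (D, 0), (- D, 0)} \<union>
      F ` (square_leg_roots D \<times> {1, - 1} \<times> {1, - 1}))"
    using fin by simp
  ultimately show False
    using assms finite_subset by blast
qed

section \<open>Distances on the hyperbola\<close>

definition hyperbola_point :: "real \<Rightarrow> real \<Rightarrow> real \<Rightarrow> real \<Rightarrow> real \<Rightarrow> real \<times> real" where
  "hyperbola_point a b c D u = (u - c / a, - 2 * D / u - b / a)"

lemma inj_hyperbola_point: "inj (hyperbola_point a b c D)"
  by (auto simp: inj_def hyperbola_point_def)

lemma hyperbola_point_rational: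
  assumes "a \<in> \<rat>" "b \<in> \<rat>" "c \<in> \<rat>" "a \<noteq> 0" "D \<in> \<rat>"
    and "D = (a * d - b * c) / (2 * a ^ 2)" and "u \<in> \<rat>" "u \<noteq> 0"
  shows "hyperbola_point a b c D u \<in> rational_points (conic_section a b c d)"
proof -
  have d: "d = (2 * a ^ 2 * D + b * c) / a"
    using assms(4,6) by (simp add: field_simps)
  have "a * (u - c / a) * (- 2 * D / u - b / a) + b * (u - c / a) + c * (- 2 * D / u - b / a) + d = 0"
    unfolding d using assms(4,8) by (simp add: field_simps power2_eq_square)
  then show ?thesis
    using assms(1-5,7,8)
    by (simp add: hyperbola_point_def rational_points_def conic_section_def)
qed

lemma dist_hyperbola_point_Rats:
  assumes "rational_leg D (u * w)" "u \<in> \<rat>" "w \<in> \<rat>"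
  shows "dist (hyperbola_point a b c D u) (hyperbola_point a b c D w) \<in> \<rat>"
proof -
  from assms(1) obtain r where nz: "u \<noteq> 0" "w \<noteq> 0"
    and r: "r \<in> \<rat>" "(u * w) ^ 2 + 4 * D ^ 2 = r ^ 2"
    unfolding rational_leg_def by auto
  have "(u - w) ^ 2 + (- 2 * D / u + 2 * D / w) ^ 2
      = ((u - w) / (u * w)) ^ 2 * ((u * w) ^ 2 + 4 * D ^ 2)"
    using nz by (simp add: field_simps power2_eq_square)
  also have "\<dots> = ((u - w) * r / (u * w)) ^ 2"
    unfolding r(2) by (simp add: power_mult_distrib power_divide)
  finally have "dist (hyperbola_point a b c D u) (hyperbola_point a b c D w)
      = \<bar>(u - w) * r / (u * w)\<bar>"
    by (simp add: hyperbola_point_def dist_prod_def dist_real_def algebra_simps del: abs_divide)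
  then show ?thesis
    using assms r by (simp add: Rats_abs_iff del: abs_divide)
qed

section \<open>Quadruples from three square legs\<close>

text \<open>A solution of \<open>u\<^sub>1 * u\<^sub>2 = r\<^sup>2\<close>, \<open>u\<^sub>1 * u\<^sub>3 = s\<^sup>2\<close>,
  \<open>u\<^sub>1 * u\<^sub>4 = t\<^sup>2\<close> and \<open>u\<^sub>1 * u\<^sub>2 * u\<^sub>3 * u\<^sub>4 = 4 * D\<^sup>2\<close>.\<close>

definition quadruple :: "real \<Rightarrow> real \<Rightarrow> real \<Rightarrow> real \<Rightarrow> real set" where
  "quadruple D r s t = {r * s * t / (2 * D),
     2 * D * r / (s * t), 2 * D * s / (r * t), 2 * D * t / (r * s)}"

lemma quadruple_Rats:
  assumes "r \<in> square_leg_roots D" "s \<in> square_leg_roots D" "t \<in> square_leg_roots D"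
    and "D \<in> \<rat>" "D \<noteq> 0"
  shows "quadruple D r s t \<subseteq> \<rat> - {0}"
  using assms by (auto simp: quadruple_def square_leg_roots_def)

text \<open>A product with the first member is the square of one of the three roots, and
  any other product is \<open>4 * D\<^sup>2\<close> divided by such a square, hence a swapped leg.\<close>

lemma rational_leg_quadruple:
  assumes roots: "r \<in> square_leg_roots D" "s \<in> square_leg_roots D" "t \<in> square_leg_roots D"
    and D: "D \<in> \<rat>" "D \<noteq> 0"
    and "u \<in> quadruple D r s t" "w \<in> quadruple D r s t" "u \<noteq> w"
  shows "rational_leg D (u * w)"
proof -
  have pos: "r > 0" "s > 0" "t > 0"
    and legs: "rational_leg D (r ^ 2)" "rational_leg D (s ^ 2)" "rational_leg D (t ^ 2)"
    using roots by (auto simp: square_leg_roots_def)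
  note swapped = legs[THEN rational_leg_swap, OF D]
  have "u * w \<in> {r ^ 2, s ^ 2, t ^ 2, 4 * D ^ 2 / r ^ 2, 4 * D ^ 2 / s ^ 2, 4 * D ^ 2 / t ^ 2}"
    using assms(6-8) pos D unfolding quadruple_def
    by (elim insertE emptyE; hypsubst) (simp_all add: field_simps power2_eq_square)
  then show ?thesis
    using legs swapped by auto
qed

text \<open>For positive roots, two members of a quadruple coincide only if two roots are equal or
  two roots have product \<open>2 * \<bar>D\<bar>\<close>.\<close>

lemma card_quadruple:
  assumes "r > 0" "s > 0" "t > 0" "D \<noteq> 0" "r \<noteq> s" "r \<noteq> t" "s \<noteq> t"
    and "r * s \<noteq> 2 * \<bar>D\<bar>" "r * t \<noteq> 2 * \<bar>D\<bar>" "s * t \<noteq> 2 * \<bar>D\<bar>"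
  shows "card (quadruple D r s t) = 4"
proof -
  have sq: "x = y" if "x * x = y * y" "x > 0" "y > 0" for x y :: real
    using that by (metis less_imp_le power2_eq_iff_nonneg power2_eq_square)
  have outer: "x * y * z / (2 * D) \<noteq> 2 * D * x / (y * z)"
    if "x > 0" "y > 0" "z > 0" "y * z \<noteq> 2 * \<bar>D\<bar>" for x y z
  proof
    assume "x * y * z / (2 * D) = 2 * D * x / (y * z)"
    then have "(y * z) * (y * z) = (2 * \<bar>D\<bar>) * (2 * \<bar>D\<bar>)"
      using that \<open>D \<noteq> 0\<close> by (simp add: field_simps)
    then show False
      using sq[of "y * z" "2 * \<bar>D\<bar>"] that \<open>D \<noteq> 0\<close> by simp
  qed
  have inner: "2 * D * x / (y * z) \<noteq> 2 * D * y / (x * z)"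
    if "x > 0" "y > 0" "z > 0" "x \<noteq> y" for x y z
  proof
    assume "2 * D * x / (y * z) = 2 * D * y / (x * z)"
    then have "x * x = y * y"
      using that \<open>D \<noteq> 0\<close> by (simp add: field_simps)
    then show False using sq that by blast
  qed
  have "r * s * t / (2 * D) \<noteq> 2 * D * r / (s * t)"
    "r * s * t / (2 * D) \<noteq> 2 * D * s / (r * t)"
    "r * s * t / (2 * D) \<noteq> 2 * D * t / (r * s)"
    using outer[of r s t] outer[of s r t] outer[of t r s] assms by (simp_all add: mult_ac)
  moreover have "2 * D * r / (s * t) \<noteq> 2 * D * s / (r * t)"
    "2 * D * r / (s * t) \<noteq> 2 * D * t / (r * s)"
    "2 * D * s / (r * t) \<noteq> 2 * D * t / (r * s)"
    using inner[of r s t] inner[of r t s] inner[of s t r] assms by (simp_all add: mult_ac)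
  ultimately show ?thesis
    unfolding quadruple_def by (subst card_insert_disjoint; simp)+
qed

lemma rational_distance_set_quadruple:
  assumes "a \<in> \<rat>" "b \<in> \<rat>" "c \<in> \<rat>" "a \<noteq> 0"
    and D: "D \<in> \<rat>" "D = (a * d - b * c) / (2 * a ^ 2)" "D \<noteq> 0"
    and roots: "r \<in> square_leg_roots D" "s \<in> square_leg_roots D" "t \<in> square_leg_roots D"
  shows "rational_distance_set (conic_section a b c d)
    (hyperbola_point a b c D ` quadruple D r s t)"
proof -
  let ?H = "hyperbola_point a b c D"
  have rat: "u \<in> \<rat>" "u \<noteq> 0" if "u \<in> quadruple D r s t" for u
    using quadruple_Rats[OF roots D(1,3)] that by auto
  have "dist (?H u) (?H w) \<in> \<rat>"
    if uw: "u \<in> quadruple D r s t" "w \<in> quadruple D r s t" for u w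
  proof (cases "u = w")
    case False
    then show ?thesis
      using rational_leg_quadruple[OF roots D(1,3) uw] rat uw
      by (intro dist_hyperbola_point_Rats) auto
  qed simp
  then show ?thesis
    unfolding rational_distance_set_def
    using hyperbola_point_rational[OF assms(1-4) D(1,2) rat] by auto
qed

theorem theorem1:
  fixes a b c d D :: real
  assumes "a \<in> \<rat>" and "b \<in> \<rat>" and "c \<in> \<rat>" and "d \<in> \<rat>"
    and "a \<noteq> 0"
    and "D = (a * d - b * c) / (2 * a ^ 2)"
    and "D \<noteq> 0"
    and "infinite (rational_points (elliptic_curve D))"
  shows "infinite {S. rational_distance_set (conic_section a b c d) S \<and> card S = 4}"
proof
  let ?F = "{S. rational_distance_set (conic_section a b c d) S \<and> card S = 4}"
  let ?H = "hyperbola_point a b c D"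
  assume fin: "finite ?F"
  have DQ: "D \<in> \<rat>"
    using assms(1-4) by (simp add: assms(6))
  let ?T = "square_leg_roots D"
  have T: "infinite ?T"
    using infinite_square_leg_roots[OF assms(8)] .
  have pos: "t > 0" if "t \<in> ?T" for t
    using that by (simp add: square_leg_roots_def)
  obtain r where r: "r \<in> ?T"
    using T infinite_imp_nonempty by blast
  have "infinite (?T - {r, 2 * \<bar>D\<bar> / r})"
    using T by simp
  then obtain s where s: "s \<in> ?T" "s \<noteq> r" "s \<noteq> 2 * \<bar>D\<bar> / r"
    using infinite_imp_nonempty by blast
  \<comment> \<open>The values removed here are those at which two members of the quadruple coincide.\<close>
  define U where "U = ?T - {r, s, 2 * \<bar>D\<bar> / r, 2 * \<bar>D\<bar> / s}"
  have U: "infinite U"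
    unfolding U_def using T by simp
  have mem: "?H (r * s * t / (2 * D)) \<in> \<Union> ?F" if "t \<in> U" for t
  proof -
    have t: "t \<in> ?T" "t \<noteq> r" "t \<noteq> s" "t \<noteq> 2 * \<bar>D\<bar> / r" "t \<noteq> 2 * \<bar>D\<bar> / s"
      using that by (auto simp: U_def)
    have "card (quadruple D r s t) = 4"
      using pos[OF r] pos[OF s(1)] pos[OF t(1)] s t assms(7)
      by (intro card_quadruple) (auto simp: field_simps)
    then have "card (?H ` quadruple D r s t) = 4"
      using card_image inj_on_subset[OF inj_hyperbola_point] by (metis subset_UNIV)
    moreover have "rational_distance_set (conic_section a b c d) (?H ` quadruple D r s t)"
      using assms DQ r s(1) t(1) by (intro rational_distance_set_quadruple) auto
    moreover have "?H (r * s * t / (2 * D)) \<in> ?H ` quadruple D r s t"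
      by (simp add: quadruple_def)
    ultimately show ?thesis by blast
  qed
  have "inj_on (\<lambda>t. ?H (r * s * t / (2 * D))) U"
    using pos[OF r] pos[OF s(1)] assms(7)
    by (auto intro!: inj_onI dest!: injD[OF inj_hyperbola_point])
  then have "infinite ((\<lambda>t. ?H (r * s * t / (2 * D))) ` U)"
    using U finite_imageD by blast
  moreover have "(\<lambda>t. ?H (r * s * t / (2 * D))) ` U \<subseteq> \<Union> ?F"
    using mem by blast
  moreover have "finite (\<Union> ?F)"
    using fin by (intro finite_Union) (auto intro: card_ge_0_finite)
  ultimately show False
    using finite_subset by blast
qed

end
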